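(* For every integer $n>58$ there are at least $3248$ prime numbers $p$ with $n<p<520n$. *)

theory Defs
  imports Complex_Main "HOL-Computational_Algebra.Primes"
begin

end

theory Submission
  imports Defs "HOL-Number_Theory.Eratosthenes"
begin

text \<open>
  For \<open>n \<le> 178\<close> the interval contains \<open>{178<..<30680}\<close>, whose primes are counted by Legendre's
  formula. For \<open>n \<ge> 178\<close>, let \<open>x = 520 n - 1 = 2 m + 1\<close>. Any common multiple of \<open>1, \<dots>, x\<close> is at
  least \<open>4 ^ m\<close>. The least one is a product of prime powers \<open>p ^ e \<le> x\<close>, where \<open>e = 1\<close> if
  \<open>p > sqrt x\<close>; bounding the primes in \<open>(sqrt x, n]\<close> by the primorial of \<open>n\<close> and all other
  prime powers by \<open>x\<close> yields \<open>4 ^ m \<le> x ^ (sqrt x + K) * 8 ^ n\<close>, with \<open>K\<close> the number of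
  primes in \<open>(n, x]\<close>.
\<close>

section \<open>Legendre's sieve formula\<close>

text \<open>
  The case \<open>x < p\<close> is correct only when \<open>ps\<close> lists all primes below \<open>p\<close>, so that only \<open>1\<close>
  survives the sieve; hence lists are in decreasing order.
\<close>

primrec legendre_phi :: "int list \<Rightarrow> int \<Rightarrow> int" where
  "legendre_phi [] x = x"
| "legendre_phi (p # ps) x =
    (if x < p then 1 else legendre_phi ps x - legendre_phi ps (x div p))"

text \<open>Survivors of \<open>ps\<close> up to \<open>x\<close> are either survivors of
  \<open>p # ps\<close> or multiples \<open>p * l\<close>. In the latter case \<open>l\<close> runs
  through the survivors of \<open>ps\<close> up to \<open>x div p\<close>, since \<open>p\<close> is
  not divisible by any smaller prime. This is the recursion of \<open>legendre_phi\<close>.\<close>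

lemma legendre_phi_eq_card:
  assumes "sorted_wrt (>) ps" "set ps = {q. prime q \<and> q \<le> N}" "x \<ge> 1"
  shows "legendre_phi ps x = int (card {k \<in> {1..x}. \<forall>q \<in> set ps. \<not> q dvd k})"
  using assms
proof (induction ps arbitrary: N x)
  case Nil
  have "{k \<in> {1..x}. \<forall>q \<in> set []. \<not> q dvd k} = {1..x}" by auto
  then show ?case using Nil.prems(3) by (simp only: card_atLeastAtMost_int legendre_phi.simps)
next
  case (Cons p ps)
  define S where "S y = {k \<in> {1..y}. \<forall>q \<in> set ps. \<not> q dvd k}" for y
  have p: "prime p" using Cons.prems(2) by auto
  then have p0: "p > 0" by (rule prime_gt_0_int)
  have less_p: "q < p" if "q \<in> set ps" for q
    using Cons.prems(1) that by auto
  have mem_iff: "q = p \<or> q \<in> set ps \<longleftrightarrow> prime q \<and> q \<le> N" for q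
    using Cons.prems(2) by (simp add: set_eq_iff)
  \<comment> \<open>The tail again consists of all primes up to a bound, now \<open>p - 1\<close>,
    so the induction hypothesis applies with this value in place of \<open>N\<close>.\<close>
  have set_ps: "set ps = {q. prime q \<and> q \<le> p - 1}"
  proof (intro set_eqI iffI)
    fix q assume "q \<in> set ps"
    then show "q \<in> {q. prime q \<and> q \<le> p - 1}" using less_p[of q] mem_iff[of q] by simp
  next
    fix q assume "q \<in> {q. prime q \<and> q \<le> p - 1}"
    then show "q \<in> set ps" using mem_iff[of p] mem_iff[of q] by simp
  qed
  have IH: "legendre_phi ps y = int (card (S y))" if "y \<ge> 1" for y
    unfolding S_def using Cons.IH[OF _ set_ps that] Cons.prems(1) by simp
  show ?case
  proof (cases "x < p")
    case True
    have "{k \<in> {1..x}. \<forall>q \<in> set (p # ps). \<not> q dvd k} = {1}"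
    proof (intro equalityI subsetI)
      fix k assume k: "k \<in> {k \<in> {1..x}. \<forall>q \<in> set (p # ps). \<not> q dvd k}"
      show "k \<in> {1}"
      proof (rule ccontr)
        assume "k \<notin> {1}"
        then obtain q where q: "prime q" "q dvd k"
          using k prime_factor_int[of k] by auto
        then have "q \<le> k" using k zdvd_imp_le by auto
        then have "q \<in> set ps" using set_ps q k True by auto
        then show False using k q by auto
      qed
    next
      fix k :: int assume "k \<in> {1}"
      moreover have "\<not> q dvd 1" if "q \<in> set (p # ps)" for q
        using that mem_iff[of q] not_prime_unit[of q] by auto
      ultimately show "k \<in> {k \<in> {1..x}. \<forall>q \<in> set (p # ps). \<not> q dvd k}"
        using Cons.prems(3) by auto
    qed
    then show ?thesis using True by simp
  next
    case False
    have "S x = {k \<in> {1..x}. \<forall>q \<in> set (p # ps). \<not> q dvd k} \<union> (*) p ` S (x div p)"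
    proof (intro equalityI subsetI)
      fix k assume k: "k \<in> S x"
      show "k \<in> {k \<in> {1..x}. \<forall>q \<in> set (p # ps). \<not> q dvd k} \<union> (*) p ` S (x div p)"
      proof (cases "p dvd k")
        case True
        then obtain l where l: "k = p * l" by auto
        have "l \<ge> 1" using k l p0 unfolding S_def by (auto simp: zero_less_mult_iff int_one_le_iff_zero_less)
        moreover have "l \<le> x div p"
          using zdiv_mono1[of k x p] k p0 l unfolding S_def by auto
        ultimately have "l \<in> S (x div p)"
          using k l unfolding S_def by auto
        then show ?thesis using l by auto
      qed (use k in \<open>auto simp: S_def\<close>)
    next
      fix k assume "k \<in> {k \<in> {1..x}. \<forall>q \<in> set (p # ps). \<not> q dvd k} \<union> (*) p ` S (x div p)"
      then show "k \<in> S x"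
      proof
        assume "k \<in> (*) p ` S (x div p)"
        then obtain l where l: "k = p * l" "1 \<le> l" "l \<le> x div p" "\<forall>q \<in> set ps. \<not> q dvd l"
          unfolding S_def by auto
        have "p * l \<le> p * (x div p)" using l p0 by simp
        also have "\<dots> \<le> x" using p0 by (simp flip: minus_mod_eq_mult_div)
        finally have "k \<le> x" using l by simp
        moreover have "1 \<le> k" using l p0 by (simp add: int_one_le_iff_zero_less)
        moreover have "\<not> q dvd k" if "q \<in> set ps" for q
        proof
          assume "q dvd k"
          moreover have "prime q" "q < p" using that set_ps by auto
          moreover have "\<not> q dvd p"
            using \<open>prime q\<close> \<open>q < p\<close> p primes_dvd_imp_eq by blast
          ultimately show False using l that by (auto simp: prime_dvd_mult_iff)
        qed
        ultimately show "k \<in> S x" unfolding S_def by auto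
      qed (auto simp: S_def)
    qed
    moreover have "card (\<dots>) = card {k \<in> {1..x}. \<forall>q \<in> set (p # ps). \<not> q dvd k} + card ((*) p ` S (x div p))"
    proof (rule card_Un_disjoint)
      show "finite {k \<in> {1..x}. \<forall>q \<in> set (p # ps). \<not> q dvd k}"
        by (rule finite_subset[of _ "{1..x}"]) auto
      have "finite (S (x div p))"
        unfolding S_def by (rule finite_subset[of _ "{1..x div p}"]) auto
      then show "finite ((*) p ` S (x div p))" by simp
    qed auto
    moreover have "card ((*) p ` S (x div p)) = card (S (x div p))"
      using p0 by (intro card_image) (auto simp: inj_on_def)
    moreover have "x div p \<ge> 1"
      using False p0 by (simp add: int_one_le_iff_zero_less pos_imp_zdiv_pos_iff)
    ultimately show ?thesis using False IH[of x] IH[of "x div p"] Cons.prems(3) by simp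
  qed
qed

section \<open>Primes between 178 and 30680\<close>

text \<open>If \<open>k = q * r\<close> with \<open>q\<close> prime and \<open>r > 1\<close>, then
  \<open>q\<close> and some prime factor of \<open>r\<close> both exceed \<open>N\<close>, which
  forces \<open>k\<close> to be at least \<open>(N + 1)\<^sup>2\<close>.\<close>

lemma prime_if_no_small_prime_factor:
  fixes k N :: int
  assumes "k > 1" "k < (N + 1)\<^sup>2" "N \<ge> 0" "\<And>q. prime q \<Longrightarrow> q \<le> N \<Longrightarrow> \<not> q dvd k"
  shows "prime k"
proof -
  obtain q where q: "prime q" "q dvd k" using assms(1) prime_factor_int[of k] by auto
  then obtain r where r: "k = q * r" by auto
  have q0: "q > 0" using q prime_gt_0_int by auto
  have "q * r > 0" using assms(1) r by simp
  then have r0: "r > 0" using q0 by (simp add: zero_less_mult_iff)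
  show ?thesis
  proof (cases "r = 1")
    case False
    then obtain s where s: "prime s" "s dvd r" using r0 prime_factor_int[of r] by auto
    then have "s \<le> r" using r0 zdvd_imp_le by auto
    moreover have "s \<ge> N + 1" "q \<ge> N + 1" using assms(4)[of s] assms(4)[of q] q s r by force+
    ultimately have "(N + 1) * (N + 1) \<le> q * r" using assms(3) by (intro mult_mono) auto
    then show ?thesis using assms(2) r by (simp add: power2_eq_square)
  qed (use q r in simp)
qed

text \<open>The bound 178 is chosen since the next prime is 179 and \<open>179\<^sup>2 > 30679\<close>.\<close>

lemma primes_le_178: "rev (map int (primes_upto 178)) =
  [173, 167, 163, 157, 151, 149, 139, 137, 131, 127, 113, 109, 107, 103, 101, 97, 89, 83, 79, 73,
   71, 67, 61, 59, 53, 47, 43, 41, 37, 31, 29, 23, 19, 17, 13, 11, 7, 5, 3, 2]"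
  by code_simp

lemma legendre_phi_178: "legendre_phi
  [173, 167, 163, 157, 151, 149, 139, 137, 131, 127, 113, 109, 107, 103, 101, 97, 89, 83, 79, 73,
   71, 67, 61, 59, 53, 47, 43, 41, 37, 31, 29, 23, 19, 17, 13, 11, 7, 5, 3, 2] 30679 = 3270"
  by code_simp

text \<open>The 3270 survivors of the sieve up to 30679 are 1 and primes above 178. The upper end is
  \<open>30680 = 520 * 59\<close>, where 59 is the least \<open>n\<close> in question.\<close>

lemma card_primes_178_30680: "card {p :: int. prime p \<and> 178 < p \<and> p < 30680} \<ge> 3269"
proof -
  let ?ps = "rev (map int (primes_upto 178))"
  let ?S = "{k \<in> {1..30679}. \<forall>q \<in> set ?ps. \<not> q dvd k}"
  have set_ps: "set ?ps = {q. prime q \<and> q \<le> 178}"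
  proof (intro equalityI subsetI)
    fix q :: int assume "q \<in> {q. prime q \<and> q \<le> 178}"
    then have "nat q \<in> set (primes_upto 178)" "q = int (nat q)"
      by (auto simp: set_primes_upto prime_ge_0_int)
    then show "q \<in> set ?ps" by (metis image_eqI list.set_map set_rev)
  qed (auto simp: set_primes_upto)
  have "sorted_wrt (>) ?ps"
    unfolding primes_le_178 by simp
  from legendre_phi_eq_card[OF this set_ps, of 30679]
  have card_S: "card ?S = 3270"
    unfolding primes_le_178 legendre_phi_178 by simp
  have "?S \<subseteq> insert 1 {p. prime p \<and> 178 < p \<and> p < 30680}"
  proof
    fix k assume k: "k \<in> ?S"
    have k_dvd: "\<not> q dvd k" if "prime q" "q \<le> 178" for q
      using k that unfolding set_ps by auto
    have "prime k" if "k \<noteq> 1"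
      using k that k_dvd by (intro prime_if_no_small_prime_factor[of k 178]) auto
    then show "k \<in> insert 1 {p. prime p \<and> 178 < p \<and> p < 30680}"
      using k k_dvd[of k] by force
  qed
  moreover have fin: "finite {p :: int. prime p \<and> 178 < p \<and> p < 30680}"
    by (rule finite_subset[of _ "{178..30680}"]) auto
  ultimately have "card ?S \<le> card (insert (1::int) {p. prime p \<and> 178 < p \<and> p < 30680})"
    by (intro card_mono) simp_all
  also have "\<dots> = Suc (card {p :: int. prime p \<and> 178 < p \<and> p < 30680})"
    using fin by (rule card_insert_disjoint) simp
  finally show ?thesis using card_S by simp
qed

section \<open>Lower bound for common multiples\<close>

text \<open>
  In Leibniz's harmonic triangle each entry \<open>1 / (Suc n * (n choose k))\<close> is an integer
  combination of \<open>1 / 1, \<dots>, 1 / Suc n\<close>.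
\<close>

lemma Suc_times_binomial_dvd:
  fixes M :: nat
  assumes "k \<le> n" "\<And>j. 0 < j \<Longrightarrow> j \<le> Suc n \<Longrightarrow> j dvd M"
  shows "Suc n * (n choose k) dvd M"
proof -
  have "real M / (real (Suc n) * real (n choose k)) \<in> \<int>"
    using assms
  proof (induction k arbitrary: n)
    case 0
    then have "Suc n dvd M" by blast
    then obtain l where "M = Suc n * l" by (rule dvdE)
    then have "real M = real (Suc n) * real l" by (simp only: of_nat_mult)
    then show ?case by simp
  next
    case (Suc k)
    then obtain n' where n: "n = Suc n'" and k: "k \<le> n'" by (cases n) auto
    define a where "a = real (n' choose k)"
    have a0: "a > 0" using k by (simp add: a_def)
    have 1: "real (Suc n' choose Suc k) = (real n' + 1) / (real k + 1) * a"
      using arg_cong[OF Suc_times_binomial[of k n'], of real] unfolding a_def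
      by (simp add: field_simps del: binomial_Suc_Suc)
    have "(Suc n' - k) * (Suc n' choose k) = Suc n' * (n' choose k)"
      using binomial_absorb_comp[of "Suc n'" k] by simp
    from arg_cong[OF this, of real]
    have 2: "real (Suc n' choose k) = (real n' + 1) / (real n' + 1 - real k) * a"
      using k unfolding a_def by (simp add: field_simps of_nat_diff)
    have "real k \<le> real n'" using k by simp
    then have pos: "real n' + 1 - real k > 0" by linarith
    \<comment> \<open>The recurrence of the triangle: the entry at \<open>(n, Suc k)\<close> is the
      entry at \<open>(n', k)\<close> minus the entry at \<open>(n, k)\<close>. Facts
      \<open>1\<close> and \<open>2\<close> express all binomials through \<open>a\<close>, so that
      it becomes an identity of fractions.\<close>
    have "real M / (real (Suc n) * real (n choose Suc k)) =
      real M / (real (Suc n') * real (n' choose k)) - real M / (real (Suc n) * real (n choose k))"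
      unfolding n 1 2 a_def[symmetric] using pos a0
      by (simp add: divide_simps) (simp add: algebra_simps)
    moreover have "real M / (real (Suc n') * real (n' choose k)) \<in> \<int>"
      using k Suc.prems by (intro Suc.IH) (auto simp: n)
    moreover have "real M / (real (Suc n) * real (n choose k)) \<in> \<int>"
      using Suc.prems by (intro Suc.IH) auto
    ultimately show ?case by (metis Ints_diff)
  qed
  then have "real M / real (Suc n * (n choose k)) \<in> \<int>"
    by (simp only: of_nat_mult)
  then obtain z where z: "real M = of_int z * real (Suc n * (n choose k))"
    using assms(1) by (elim Ints_cases) (simp add: nonzero_divide_eq_eq del: of_nat_Suc of_nat_mult mult_Suc)
  have "int M = z * int (Suc n * (n choose k))"
    using z by (metis of_int_eq_iff of_int_mult of_int_of_nat_eq)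
  then have "int (Suc n * (n choose k)) dvd int M" by (metis dvd_triv_right)
  then show ?thesis by (simp only: int_dvd_int_iff)
qed

text \<open>Row \<open>2 * m\<close> of Pascal's triangle has sum \<open>4 ^ m\<close> and
  \<open>2 * m + 1\<close> entries, none above the central one; and \<open>2 * m + 1\<close> times
  the central one divides \<open>M\<close>.\<close>

lemma four_pow_le_if_dvd:
  fixes M :: nat
  assumes "M > 0" "\<And>j. 0 < j \<Longrightarrow> j \<le> 2 * m + 1 \<Longrightarrow> j dvd M"
  shows "4 ^ m \<le> M"
proof -
  have "(4::nat) ^ m = (\<Sum>k\<le>2 * m. 2 * m choose k)"
    by (simp only: choose_row_sum power_mult) simp
  also have "\<dots> \<le> (\<Sum>k\<le>2 * m. 2 * m choose m)"
    by (intro sum_mono binomial_maximum')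
  also have "\<dots> = Suc (2 * m) * (2 * m choose m)" by simp
  also have "\<dots> \<le> M"
    using assms by (intro dvd_imp_le[OF _ assms(1)] Suc_times_binomial_dvd) auto
  finally show ?thesis .
qed

section \<open>Upper bound for the primorial\<close>

lemma prod_primes_dvd:
  fixes x :: nat
  assumes "finite A" "\<And>p. p \<in> A \<Longrightarrow> prime p" "\<And>p. p \<in> A \<Longrightarrow> p dvd x"
  shows "\<Prod>A dvd x"
  using assms
proof (induction A rule: finite_induct)
  case (insert p A)
  have "coprime p (\<Prod>A)"
    using insert by (intro prod_coprime_right primes_coprime) auto
  then show ?case using insert by (simp add: divides_mult)
qed simp

text \<open>Halving \<open>n\<close>: primes up to the half are covered by induction, and the
  product of the others divides a binomial coefficient, which is at most
  \<open>2 ^ n\<close>.\<close>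

lemma primorial_le: "\<Prod>{p :: nat. prime p \<and> p \<le> n} \<le> 8 ^ n"
proof (induction n rule: less_induct)
  case (less n)
  show ?case
  proof (cases "n \<le> 2")
    case True
    have "{p :: nat. prime p \<and> p \<le> n} \<subseteq> {2}"
      using True by (auto dest: prime_ge_2_nat)
    then have "{p :: nat. prime p \<and> p \<le> n} \<in> {{}, {2}}"
      by auto
    moreover have "n = 2" if "{p :: nat. prime p \<and> p \<le> n} = {2}"
      using that True by (auto dest!: equalityD2)
    ultimately show ?thesis by (elim insertE emptyE) (simp_all del: Collect_empty_eq)
  next
    case False
    \<comment> \<open>Primes in \<open>(h, n]\<close> divide \<open>n choose k\<close>.\<close>
    define k h where "k = n div 2" and "h = n - k"
    \<comment> \<open>As \<open>h\<close> is half of \<open>n\<close> rounded up, the last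
      inequality is tight at \<open>n = 3\<close> and would fail at \<open>n = 1\<close>.\<close>
    have kh: "h < n" "k \<le> h" "n = k + h" "3 * h + n \<le> 3 * n"
      using False unfolding k_def h_def by auto
    let ?A = "{p :: nat. prime p \<and> h < p \<and> p \<le> n}"
    have "{p. prime p \<and> p \<le> n} = {p. prime p \<and> p \<le> h} \<union> ?A"
      using kh by auto
    then have "\<Prod>{p. prime p \<and> p \<le> n} = \<Prod>{p. prime p \<and> p \<le> h} * \<Prod>?A"
      by (simp, intro prod.union_disjoint) (auto intro: finite_subset[of _ "{..n}"])
    also have "\<dots> \<le> 8 ^ h * 2 ^ n"
    proof (intro mult_mono)
      have "\<Prod>?A dvd n choose k"
      proof (rule prod_primes_dvd)
        fix p assume p: "p \<in> ?A"
        then have "p dvd fact n" by (simp add: prime_dvd_fact_iff)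
        also have "fact n = fact k * fact h * (n choose k)"
          using binomial_fact_lemma[of k n] kh by simp
        finally show "p dvd n choose k"
          using p kh by (auto simp: prime_dvd_mult_iff prime_dvd_fact_iff)
      qed auto
      then have "\<Prod>?A \<le> n choose k"
        using kh by (intro dvd_imp_le) auto
      then show "\<Prod>?A \<le> 2 ^ n" using binomial_le_pow2 order_trans by blast
    qed (use less[OF kh(1)] in auto)
    also have "\<dots> = 2 ^ (3 * h + n)"
      by (simp add: power_add power_mult)
    also have "\<dots> \<le> 2 ^ (3 * n)" using kh by (intro power_increasing) auto
    finally show ?thesis by (simp add: power_mult)
  qed
qed

section \<open>From common multiples to a count of primes\<close>

text \<open>The power of \<open>p\<close> in \<open>j\<close> is at most
  \<open>j \<le> x < p ^ Suc (e p)\<close>, so its exponent is at most \<open>e p\<close>. This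
  makes the product a common multiple of \<open>1, ..., x\<close>.\<close>

lemma dvd_prod_prime_powers:
  fixes j :: nat
  assumes "0 < j" "j \<le> x" "\<And>p. prime p \<Longrightarrow> p \<le> x \<Longrightarrow> x < p ^ Suc (e p)"
  shows "j dvd (\<Prod>p | prime p \<and> p \<le> x. p ^ e p)"
proof -
  have le_x: "p \<le> x" if "p \<in> prime_factors j" for p
    using that assms(1,2) dvd_imp_le[of p j] by auto
  have "j = (\<Prod>p \<in> prime_factors j. p ^ multiplicity p j)"
    using prod_prime_factors[of j] assms(1) by simp
  also have "\<dots> dvd (\<Prod>p | prime p \<and> p \<le> x. p ^ e p)"
  proof (rule prod_dvd_prod_subset2)
    show "prime_factors j \<subseteq> {p. prime p \<and> p \<le> x}"
      using le_x by auto
    fix p assume p: "p \<in> prime_factors j"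
    then have "p \<le> x" using le_x by simp
    have "p ^ multiplicity p j \<le> j" using assms(1) by (intro dvd_imp_le multiplicity_dvd) auto
    also note \<open>j \<le> x\<close>
    also have "x < p ^ Suc (e p)" using assms(3)[OF _ \<open>p \<le> x\<close>] p by (simp add: in_prime_factors_iff)
    finally have "p ^ multiplicity p j < p ^ Suc (e p)" .
    moreover have "p > 1" using p prime_gt_1_nat[of p] by (simp add: in_prime_factors_iff)
    ultimately have "multiplicity p j < Suc (e p)" by (metis power_less_imp_less_exp)
    then show "p ^ multiplicity p j dvd p ^ e p" by (intro le_imp_power_dvd) auto
  qed auto
  finally show ?thesis .
qed

lemma four_pow_le_primes:
  fixes n m s :: nat
  defines "x \<equiv> 2 * m + 1"
  assumes s: "x < (s + 1)\<^sup>2" "s \<le> x" "n \<le> x"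
  shows "4 ^ m \<le> x ^ (s + card {p. prime p \<and> n < p \<and> p \<le> x}) * 8 ^ n"
proof -
  have "\<forall>p. \<exists>e. prime p \<longrightarrow> p ^ e \<le> x \<and> x < p ^ Suc e"
    using ex_power_ivl1[of _ x] by (auto simp: x_def dest: prime_ge_2_nat)
  then obtain e where e: "\<And>p. prime p \<Longrightarrow> p ^ e p \<le> x" "\<And>p. prime p \<Longrightarrow> x < p ^ Suc (e p)"
    by metis
  \<comment> \<open>The maximum in \<open>?D\<close> keeps the parts disjoint when
    \<open>s > n\<close>; then \<open>?B\<close> is empty and \<open>?D\<close> is only a part of
    \<open>?C\<close>.\<close>
  let ?A = "{p. prime p \<and> p \<le> s}" and ?B = "{p. prime p \<and> s < p \<and> p \<le> n}"
    and ?C = "{p. prime p \<and> n < p \<and> p \<le> x}"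
    and ?D = "{p. prime p \<and> max s n < p \<and> p \<le> x}"
  let ?f = "\<lambda>p. p ^ e p"
  have fin: "finite ?A" "finite ?B" "finite ?C" "finite ?D"
    by (auto intro: finite_subset[of _ "{..s}"] finite_subset[of _ "{..n}"] finite_subset[of _ "{..x}"])
  have "4 ^ m \<le> prod ?f {p. prime p \<and> p \<le> x}"
  proof (rule four_pow_le_if_dvd)
    show "prod ?f {p. prime p \<and> p \<le> x} > 0"
      by (auto intro!: prod_pos prime_gt_0_nat)
  qed (use dvd_prod_prime_powers e in \<open>auto simp: x_def\<close>)
  also have "{p. prime p \<and> p \<le> x} = ?A \<union> (?B \<union> ?D)"
    using s by auto
  also have "prod ?f \<dots> = prod ?f ?A * (prod ?f ?B * prod ?f ?D)"
    using fin s by (subst prod.union_disjoint; (subst prod.union_disjoint)?) auto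
  also have "\<dots> \<le> x ^ s * (8 ^ n * x ^ card ?C)"
  proof (intro mult_mono)
    have "prod ?f ?A \<le> x ^ card ?A" using e by (intro prod_le_power) (auto simp: x_def)
    also have "card ?A \<le> card {1..s}"
      by (intro card_mono) (auto dest: prime_gt_0_nat)
    then have "x ^ card ?A \<le> x ^ s" by (intro power_increasing) (auto simp: x_def)
    finally show "prod ?f ?A \<le> x ^ s" .
    have "prod ?f ?D \<le> x ^ card ?D" using e by (intro prod_le_power) (auto simp: x_def)
    also have "\<dots> \<le> x ^ card ?C"
      using fin by (intro power_increasing card_mono) (auto simp: x_def)
    finally show "prod ?f ?D \<le> x ^ card ?C" .
    have fin_n: "finite {p :: nat. prime p \<and> p \<le> n}"
      by (rule finite_subset[of _ "{..n}"]) auto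
    have "prod ?f ?B \<le> \<Prod>?B"
    proof (intro prod_mono conjI)
      fix p assume p: "p \<in> ?B"
      \<comment> \<open>A prime above \<open>s\<close> has its square above \<open>x\<close>, so its
        exponent is at most 1 and the primorial bound applies.\<close>
      then have "(s + 1)\<^sup>2 \<le> p\<^sup>2" by (intro power_mono) auto
      then have "x < p\<^sup>2" using s(1) by linarith
      then have less: "p ^ e p < p\<^sup>2" using e(1)[of p] p by simp
      have "p > 1" using p prime_gt_1_nat by simp
      then have "e p < 2" using less by (rule power_less_imp_less_exp)
      then have "e p = 0 \<or> e p = 1" by linarith
      then show "p ^ e p \<le> p" using \<open>p > 1\<close> by auto
    qed auto
    also have "\<Prod>?B \<le> \<Prod>{p. prime p \<and> p \<le> n}"
      by (intro dvd_imp_le prod_dvd_prod_subset)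
        (auto simp: fin_n intro!: prod_pos dest: prime_gt_0_nat)
    also have "\<dots> \<le> 8 ^ n" by (rule primorial_le)
    finally show "prod ?f ?B \<le> 8 ^ n" .
  qed auto
  finally show ?thesis by (simp add: power_add mult_ac)
qed

section \<open>Large \<open>n\<close>\<close>

text \<open>The tangent of the logarithm at 512, weakened by \<open>1 / 2 \<le> ln 2 \<le> 1\<close>.\<close>

lemma log2_le:
  assumes "y > 0"
  shows "log 2 y \<le> 8 + y / 256"
proof -
  have "ln (1 / 2 :: real) \<le> - 1 / 2"
    using ln_le_minus_one[of "1 / 2"] by simp
  then have ln2: "ln 2 \<ge> (1 / 2 :: real)" by (simp add: ln_div)
  have "log 2 y = 9 + log 2 (y / 512)"
    using assms log_pow_cancel[of "2::real" 9] by (simp add: log_divide)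
  also have "log 2 (y / 512) \<le> (y / 512 - 1) / ln 2"
    unfolding log_def using ln_le_minus_one[of "y / 512"] assms by (intro divide_right_mono) auto
  also have "\<dots> = y / 512 * (1 / ln 2) - 1 / ln 2" by (simp add: diff_divide_distrib)
  \<comment> \<open>The two bounds on \<open>ln 2\<close> serve different terms:
    \<open>1 / ln 2 \<le> 2\<close> the slope, \<open>1 \<le> 1 / ln 2\<close> the constant.\<close>
  also have "\<dots> \<le> y / 512 * 2 - 1"
  proof (rule diff_mono)
    show "y / 512 * (1 / ln 2) \<le> y / 512 * 2"
      using assms ln2 by (intro mult_left_mono) (simp_all add: field_simps)
    show "1 \<le> 1 / ln (2::real)" using ln_2_less_1 by (simp add: field_simps)
  qed
  finally show ?thesis by simp
qed

text \<open>With at most 3247 primes, taking base-2 logarithms in \<open>four_pow_le_primes\<close>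
  leaves \<open>520 * n - 2\<close> on the left, but only a small multiple of \<open>n\<close> plus
  lower-order terms on the right.\<close>

lemma card_primes_ge_large:
  fixes n :: nat
  assumes n: "n \<ge> 178"
  shows "card {p. prime p \<and> n < p \<and> p < 520 * n} \<ge> 3248"
proof (rule ccontr)
  \<comment> \<open>The largest integer below \<open>520 * n\<close> is odd, hence of the form
    \<open>2 * m + 1\<close>.\<close>
  define m x s where "m = 260 * n - 1" and "x = 2 * m + 1" and "s = nat \<lfloor>sqrt (real x)\<rfloor>"
  have x: "x = 520 * n - 1" "x < 520 * n" "n \<le> x" "x \<ge> 1" and m: "2 * m + 2 = 520 * n"
    using n unfolding x_def m_def by auto
  define C where "C = {p. prime p \<and> n < p \<and> p \<le> x}"
  have C: "C = {p. prime p \<and> n < p \<and> p < 520 * n}"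
    unfolding C_def using x by auto
  assume "\<not> card {p. prime p \<and> n < p \<and> p < 520 * n} \<ge> 3248"
  then have card_C: "card C \<le> 3247" unfolding C by simp
  have s: "real s \<le> sqrt (real x)" "sqrt (real x) < real s + 1"
    unfolding s_def by (simp_all add: of_nat_floor)
  have "sqrt (real x) * sqrt (real x) < (real s + 1) * (real s + 1)"
    using s by (intro mult_strict_mono) auto
  then have "real x < real ((s + 1)\<^sup>2)" by (simp add: power2_eq_square algebra_simps)
  then have s1: "x < (s + 1)\<^sup>2" by (simp only: of_nat_less_iff)
  have "sqrt (real x) \<le> real x"
    using x(4) real_sqrt_le_mono[of "real x" "(real x)\<^sup>2"] by (simp add: self_le_power)
  then have s2: "s \<le> x" using s by linarith
  have "4 ^ m \<le> x ^ (s + card C) * 8 ^ n"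
    using four_pow_le_primes[of m s n] s1 s2 x unfolding x_def C_def by simp
  also have "\<dots> \<le> x ^ (s + 3247) * 8 ^ n"
    using card_C x by (intro mult_right_mono power_increasing) auto
  finally have le: "real (4 ^ m) \<le> real (x ^ (s + 3247) * 8 ^ n)"
    by (simp only: of_nat_le_iff)
  define y where "y = sqrt (520 * real n)"
  have yy: "y * y = 520 * real n" unfolding y_def by simp
  \<comment> \<open>\<open>299 * 299 = 89401\<close>, while
    \<open>520 * 178 = 92560\<close>.\<close>
  have y: "y \<ge> 299" unfolding y_def using n by (intro real_le_rsqrt) auto
  have xy: "real x \<le> y * y" using x unfolding yy by linarith
  have "sqrt (real x) \<le> y" unfolding y_def using x by (intro real_sqrt_le_mono) linarith
  then have sy: "real s \<le> y" using s by linarith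
  have "2 * real m = log 2 (4 ^ m)"
    using log_pow_cancel[of "2::real" "2 * m"] by (simp add: power_mult)
  also have "\<dots> \<le> log 2 (real (x ^ (s + 3247) * 8 ^ n))"
    using le x by (subst log_le_cancel_iff) auto
  also have "\<dots> = (real s + 3247) * log 2 x + 3 * real n"
    using x log_pow_cancel[of "2::real" 3] by (simp add: log_mult log_nat_power)
  also have "log 2 x \<le> log 2 (y * y)"
    using xy x y by (subst log_le_cancel_iff) auto
  also have "log 2 (y * y) = 2 * log 2 y" using y by (simp add: log_mult)
  also have "\<dots> \<le> 2 * (8 + y / 256)" using log2_le[of y] y by simp
  finally have "2 * real m \<le> (real s + 3247) * (2 * (8 + y / 256)) + 3 * real n"
    by (simp add: mult_left_mono)
  also have "(real s + 3247) * (2 * (8 + y / 256)) \<le> (y + 3247) * (2 * (8 + y / 256))"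
    using sy y by (intro mult_right_mono) auto
  \<comment> \<open>Expanding with \<open>y * y = 520 * n\<close>:
    \<open>65 / 16 = 520 / 128\<close>, \<open>5295 / 128 = 16 + 3247 / 128\<close> and
    \<open>51952 = 16 * 3247\<close>.\<close>
  finally have "2 * real m \<le> 65 / 16 * real n + 5295 / 128 * y + 51952 + 3 * real n"
    using yy by (simp add: algebra_simps)
  moreover have "2 * real m + 2 = 520 * real n" using m by linarith
  \<comment> \<open>This bounds the term linear in \<open>y\<close> by less than
    \<open>72 * n\<close>, so the right side is below \<open>80 * n + 51952\<close>. That is less
    than \<open>520 * n - 2\<close> once \<open>n \<ge> 119\<close>, and \<open>y \<ge> 299\<close>
    gives \<open>n > 171\<close>.\<close>
  moreover have "299 * y \<le> y * y" using y by (intro mult_right_mono) auto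
  ultimately show False using y unfolding yy by linarith
qed
theorem theorem3p3p2:
  fixes n :: int
  assumes "n > 58"
  shows "card {p :: int. prime p \<and> n < p \<and> p < 520 * n} \<ge> 3248"
proof -
  have fin: "finite {p :: int. prime p \<and> n < p \<and> p < 520 * n}"
    by (rule finite_subset[of _ "{n..520 * n}"]) auto
  show ?thesis
  proof (cases "n \<le> 178")
    case True
    \<comment> \<open>Here \<open>n \<ge> 59\<close>, so \<open>520 * n\<close> is at least
      30680.\<close>
    then have "{p :: int. prime p \<and> 178 < p \<and> p < 30680} \<subseteq> {p. prime p \<and> n < p \<and> p < 520 * n}"
      using assms by auto
    from card_mono[OF fin this] show ?thesis using card_primes_178_30680 by linarith
  next
    case False
    define k where "k = nat n"
    have n: "n = int k" "k \<ge> 178" using False by (auto simp: k_def)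
    have "card {p. prime p \<and> k < p \<and> p < 520 * k} = card (int ` {p. prime p \<and> k < p \<and> p < 520 * k})"
      by (rule card_image[symmetric]) simp
    also have "\<dots> \<le> card {p :: int. prime p \<and> n < p \<and> p < 520 * n}"
      using fin by (rule card_mono) (auto simp: n(1))
    finally show ?thesis using card_primes_ge_large[OF n(2)] by linarith
  qed
qed

end
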